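(* For each positive integer $m$ there exists a nontrivial $9^m\times 9^m$ cube root signature matrix $Q$ satisfying $Q^2=(9^m-1)I_{9^m}-2Q$.
   Context: A Seidel matrix is a self-adjoint complex matrix with zero diagonal and off-diagonal entries of modulus one. A cube root Seidel matrix is a Seidel matrix all of whose off-diagonal entries are cube roots of unity. A cube root signature matrix is a cube root Seidel matrix with exactly two distinct eigenvalues. Two Seidel matrices are switching equivalent if one is obtained from the other by conjugation with a diagonal unitary matrix and a permutation matrix. A Seidel matrix is in standard form if its first row and first column contain only $1$'s except on the diagonal; every Seidel matrix is switching equivalent to one in standard form (called a standard form of it). A Seidel matrix is trivial if it has a standard form with all off-diagonal entries equal to $1$, and nontrivial if its standard form has at least one off-diagonal entry not equal to $1$ (i.e. if it is not trivial). *)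

theory Defs
  imports
    "Jordan_Normal_Form.Spectral_Radius"
    "Jordan_Normal_Form.Schur_Decomposition"
begin

text \<open>Matrices are indexed from 0, so the first row and column have index 0.
  On complex matrices \<^const>\<open>mat_adjoint\<close> is the conjugate transpose.\<close>

definition seidel_mat :: "complex mat \<Rightarrow> bool" where
  "seidel_mat A \<longleftrightarrow>
     square_mat A \<and> mat_adjoint A = A \<and>
     (\<forall>i<dim_row A. A $$ (i, i) = 0) \<and>
     (\<forall>i<dim_row A. \<forall>j<dim_row A. i \<noteq> j \<longrightarrow> cmod (A $$ (i, j)) = 1)"

definition cube_root_seidel_mat :: "complex mat \<Rightarrow> bool" where
  "cube_root_seidel_mat A \<longleftrightarrow>
     seidel_mat A \<and>
     (\<forall>i<dim_row A. \<forall>j<dim_row A. i \<noteq> j \<longrightarrow> (A $$ (i, j)) ^ 3 = 1)"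

definition cube_root_signature_mat :: "complex mat \<Rightarrow> bool" where
  "cube_root_signature_mat A \<longleftrightarrow> cube_root_seidel_mat A \<and> card (spectrum A) = 2"

definition unitary_mat :: "complex mat \<Rightarrow> bool" where
  "unitary_mat U \<longleftrightarrow>
     square_mat U \<and> inverts_mat U (mat_adjoint U) \<and> inverts_mat (mat_adjoint U) U"

definition permutation_mat :: "complex mat \<Rightarrow> bool" where
  "permutation_mat P \<longleftrightarrow>
     (\<exists>n \<pi>. \<pi> permutes {..<n} \<and> P = mat n n (\<lambda>(i, j). if j = \<pi> i then 1 else 0))"

text \<open>Diagonal unitary matrices and permutation matrices generate a group in which every
  element has the form \<open>P * D\<close>, so the order of the two conjugations is immaterial.\<close>

definition switching_equivalent :: "complex mat \<Rightarrow> complex mat \<Rightarrow> bool" where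
  "switching_equivalent A B \<longleftrightarrow>
     seidel_mat A \<and> seidel_mat B \<and> dim_row A = dim_row B \<and>
     (\<exists>D P. D \<in> carrier_mat (dim_row A) (dim_row A) \<and> diagonal_mat D \<and> unitary_mat D \<and>
            P \<in> carrier_mat (dim_row A) (dim_row A) \<and> permutation_mat P \<and>
            B = P * (D * A * mat_adjoint D) * mat_adjoint P)"

definition in_standard_form :: "complex mat \<Rightarrow> bool" where
  "in_standard_form A \<longleftrightarrow>
     seidel_mat A \<and> (\<forall>i<dim_row A. i \<noteq> 0 \<longrightarrow> A $$ (0, i) = 1 \<and> A $$ (i, 0) = 1)"

definition standard_form_of :: "complex mat \<Rightarrow> complex mat \<Rightarrow> bool" where
  "standard_form_of S A \<longleftrightarrow> in_standard_form S \<and> switching_equivalent A S"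

definition trivial_seidel_mat :: "complex mat \<Rightarrow> bool" where
  "trivial_seidel_mat A \<longleftrightarrow>
     seidel_mat A \<and>
     (\<exists>S. standard_form_of S A \<and>
          (\<forall>i<dim_row S. \<forall>j<dim_row S. i \<noteq> j \<longrightarrow> S $$ (i, j) = 1))"

text \<open>Standard forms are not unique, but a Seidel matrix with one standard form whose
  off-diagonal entries are all 1 has no other. So nontriviality says equally that some, or that
  every, standard form has an off-diagonal entry different from 1.\<close>

definition nontrivial_seidel_mat :: "complex mat \<Rightarrow> bool" where
  "nontrivial_seidel_mat A \<longleftrightarrow> seidel_mat A \<and> \<not> trivial_seidel_mat A"

end

theory Submission
  imports Defs
begin

text \<open>Adding the identity turns the equation for \<open>Q\<close> into \<open>H\<^sup>2 = 9\<^sup>m I\<close> for \<open>H = Q + I\<close>. So one needs a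
  Hermitian matrix \<open>H\<close> of cube roots of unity with unit diagonal and \<open>H\<^sup>2 = 9\<^sup>m I\<close>. For \<open>m = 1\<close> index
  by pairs over the integers modulo 3 and take the symplectic character \<open>\<omega>\<^bsup>ad - bc\<^esup>\<close>, where the
  exponent is antisymmetric and nondegenerate; Kronecker powers give all \<open>m\<close>. The matrix is
  nontrivial because conjugation preserves the quadratic equation, which the matrix with all
  off-diagonal entries 1 does not satisfy.\<close>

section \<open>Cube root kernels and their Kronecker products\<close>

lemma sum_div_mod:
  fixes f :: "nat \<Rightarrow> nat \<Rightarrow> 'a::comm_monoid_add"
  shows "(\<Sum>k<p * q. f (k div q) (k mod q)) = (\<Sum>a<p. \<Sum>b<q. f a b)"
proof -
  have "(\<Sum>b<q. f a b) = (\<Sum>k\<in>{a * q..<a * q + q}. f (k div q) (k mod q))" for a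
    by (rule sum.reindex_bij_witness[of _ "\<lambda>k. k - a * q" "\<lambda>b. a * q + b"])
       (auto simp: less_diff_conv2)
  then show ?thesis
    by (simp add: sum.nat_group)
qed

text \<open>Entries of the matrix \<open>H = Q + I\<close> as a function on all naturals. Only
  orthogonality, the entrywise form of \<open>H * H = n I\<close>, is bounded by \<open>n\<close>,
  so the pointwise laws pass to arguments such as \<open>i div q\<close> without range checks. As
  cube roots of unity have modulus one, \<open>h i j * h j i = 1\<close> says that \<open>H\<close>
  is Hermitian.\<close>

definition cube_root_kernel :: "nat \<Rightarrow> (nat \<Rightarrow> nat \<Rightarrow> complex) \<Rightarrow> bool" where
  "cube_root_kernel n h \<longleftrightarrow>
     (\<forall>i j. h i j ^ 3 = 1 \<and> h i j * h j i = 1 \<and> h i i = 1) \<and>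
     (\<forall>i<n. \<forall>j<n. (\<Sum>k<n. h i k * h k j) = (if i = j then of_nat n else 0))"

text \<open>This is the Kronecker product, with \<open>i\<close> standing for the pair
  \<open>(i div q, i mod q)\<close>. The sum over pairs factors, so the square of the product is the
  product of the squares.\<close>

lemma cube_root_kernel_product:
  assumes h: "cube_root_kernel p h" and g: "cube_root_kernel q g"
  shows "cube_root_kernel (p * q) (\<lambda>i j. h (i div q) (j div q) * g (i mod q) (j mod q))"
    (is "cube_root_kernel _ ?f")
  unfolding cube_root_kernel_def
proof (intro conjI allI impI)
  fix i j
  show "?f i j ^ 3 = 1" "?f i i = 1"
    using h g by (simp_all add: cube_root_kernel_def power_mult_distrib)
  have "?f i j * ?f j i = (h (i div q) (j div q) * h (j div q) (i div q)) *
      (g (i mod q) (j mod q) * g (j mod q) (i mod q))"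
    by (simp add: mult_ac)
  also have "\<dots> = 1"
    using h g unfolding cube_root_kernel_def by (simp only: mult_1)
  finally show "?f i j * ?f j i = 1" .
next
  fix i j assume ij: "i < p * q" "j < p * q"
  then have q: "q > 0" by (cases q) auto
  have lt: "i div q < p" "j div q < p" "i mod q < q" "j mod q < q"
    using ij q by (auto simp: less_mult_imp_div_less)
  have eq: "i = j \<longleftrightarrow> i div q = j div q \<and> i mod q = j mod q"
    by (metis div_mult_mod_eq)
  have "(\<Sum>k<p * q. ?f i k * ?f k j) = (\<Sum>a<p. \<Sum>b<q.
      (h (i div q) a * g (i mod q) b) * (h a (j div q) * g b (j mod q)))"
    by (rule sum_div_mod)
  also have "\<dots> = (\<Sum>a<p. h (i div q) a * h a (j div q)) * (\<Sum>b<q. g (i mod q) b * g b (j mod q))"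
    unfolding sum_product by (simp add: mult_ac)
  also have "\<dots> = (if i = j then of_nat (p * q) else 0)"
    using h g lt unfolding cube_root_kernel_def eq by simp
  finally show "(\<Sum>k<p * q. ?f i k * ?f k j) = (if i = j then of_nat (p * q) else 0)" .
qed

section \<open>The symplectic kernel of order 9 and its powers\<close>

lemma sum_powers_cube_root:
  fixes z :: complex
  assumes "z ^ 3 = 1"
  shows "(\<Sum>k<3. z ^ k) = (if z = 1 then 3 else 0)"
proof -
  have "(z - 1) * (\<Sum>k<3. z ^ k) = 0"
    using assms by (simp add: power_diff_1_eq[symmetric])
  then show ?thesis by auto
qed

lemma primitive_cube_root_exists:
  obtains w :: complex where "w ^ 3 = 1" "w \<noteq> 1" "w ^ 2 \<noteq> 1"
proof
  show w3: "cis (2 * pi / 3) ^ 3 = 1"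
    by (simp add: DeMoivre)
  show w1: "cis (2 * pi / 3) \<noteq> 1"
    by (simp add: complex_eq_iff cos_120)
  show "cis (2 * pi / 3) ^ 2 \<noteq> 1"
    using w3 w1 by (metis mult.right_neutral numeral_3_eq_3 numeral_2_eq_2 power_Suc)
qed

lemma cube_root_kernel_9: "\<exists>h. cube_root_kernel 9 h"
proof -
  obtain w :: complex where w: "w ^ 3 = 1" "w \<noteq> 1" "w ^ 2 \<noteq> 1"
    by (rule primitive_cube_root_exists)
  have w_mult3: "w ^ (3 * k) = 1" for k
    using w by (simp add: power_mult)
  \<comment> \<open>Modulo 3 the exponent is \<open>a - b\<close>, and \<open>w\<close> is a
    primitive cube root of unity.\<close>
  have w_eq: "w ^ (a + 2 * b) = 1 \<longleftrightarrow> a = b" if "a < 3" "b < 3" for a b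
  proof -
    have "a \<in> {0, 1, 2}" "b \<in> {0, 1, 2}" using that by auto
    moreover have "w ^ 4 = w" "w ^ 5 = w ^ 2" "w ^ 6 = 1"
      using w_mult3[of 2] w(1) power_add[of w 3 1] power_add[of w 3 2] by simp_all
    ultimately show ?thesis
      using w by (auto simp: numeral_3_eq_3)
  qed
  have geom: "(\<Sum>k<3. w ^ ((a + 2 * b) * k)) = (if a = b then 3 else 0)"
    if "a < 3" "b < 3" for a b
  proof -
    have "(w ^ (a + 2 * b)) ^ 3 = 1"
      using w_mult3[of "a + 2 * b"] by (metis power_mult mult.commute)
    from sum_powers_cube_root[OF this] show ?thesis
      by (simp only: power_mult w_eq[OF that])
  qed
  text \<open>The exponent is \<open>ad - bc\<close> modulo 3, with \<open>- bc\<close> written as \<open>2bc\<close> to stay in the naturals.\<close>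
  define e where "e i j = (i div 3) * (j mod 3) + 2 * (i mod 3) * (j div 3)" for i j :: nat
  have "cube_root_kernel 9 (\<lambda>i j. w ^ e i j)"
    unfolding cube_root_kernel_def
  proof (intro conjI allI impI)
    fix i j
    show "(w ^ e i j) ^ 3 = 1"
      using w_mult3[of "e i j"] by (simp add: power_mult[symmetric] mult.commute)
    have "e i j + e j i = 3 * ((i div 3) * (j mod 3) + (i mod 3) * (j div 3))"
      by (simp add: e_def algebra_simps)
    then show "w ^ e i j * w ^ e j i = 1"
      by (metis power_add w_mult3)
    have "e i i = 3 * ((i div 3) * (i mod 3))"
      by (simp add: e_def)
    then show "w ^ e i i = 1"
      by (metis w_mult3)
  next
    fix i j :: nat assume ij: "i < 9" "j < 9"
    then have lt: "i div 3 < 3" "j div 3 < 3" "i mod 3 < 3" "j mod 3 < 3"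
      by auto
    have eq: "i = j \<longleftrightarrow> j mod 3 = i mod 3 \<and> i div 3 = j div 3"
      by (metis div_mult_mod_eq)
    \<comment> \<open>Collecting \<open>e i k + e k j\<close> by the two ternary digits of
      \<open>k\<close> gives coefficients congruent to \<open>j mod 3 - i mod 3\<close> and
      \<open>i div 3 - j div 3\<close>. The sum thus splits into two geometric sums, both equal to 3
      when \<open>i = j\<close>, and at least one zero otherwise.\<close>
    have "(\<Sum>k<9. w ^ e i k * w ^ e k j) = (\<Sum>k<3 * 3.
        w ^ ((j mod 3 + 2 * (i mod 3)) * (k div 3)) * w ^ ((i div 3 + 2 * (j div 3)) * (k mod 3)))"
      by (simp add: e_def power_add[symmetric] algebra_simps)
    also have "\<dots> = (\<Sum>a<3. \<Sum>b<3.
        w ^ ((j mod 3 + 2 * (i mod 3)) * a) * w ^ ((i div 3 + 2 * (j div 3)) * b))"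
      by (rule sum_div_mod)
    also have "\<dots> = (\<Sum>a<3. w ^ ((j mod 3 + 2 * (i mod 3)) * a)) *
        (\<Sum>b<3. w ^ ((i div 3 + 2 * (j div 3)) * b))"
      by (simp only: sum_product)
    also have "\<dots> = (if i = j then of_nat 9 else 0)"
      using lt unfolding eq by (simp only: geom) simp
    finally show "(\<Sum>k<9. w ^ e i k * w ^ e k j) = (if i = j then of_nat 9 else 0)" .
  qed
  then show ?thesis by blast
qed

lemma cube_root_kernel_power_9: "\<exists>h. cube_root_kernel (9 ^ m) h"
proof (induction m)
  case 0
  have "cube_root_kernel 1 (\<lambda>_ _. 1)"
    by (simp add: cube_root_kernel_def)
  then show ?case by auto
next
  case (Suc m)
  then obtain h g where "cube_root_kernel 9 h" "cube_root_kernel (9 ^ m) g"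
    using cube_root_kernel_9 by blast
  from cube_root_kernel_product[OF this] show ?case
    unfolding power_Suc by blast
qed

section \<open>Spectrum of a matrix with a quadratic equation\<close>

lemma smult_mat_mult_vec:
  fixes A :: "'a::comm_ring_1 mat"
  assumes "A \<in> carrier_mat nr nc" "v \<in> carrier_vec nc"
  shows "(k \<cdot>\<^sub>m A) *\<^sub>v v = k \<cdot>\<^sub>v (A *\<^sub>v v)"
  using assms by (intro eq_vecI) (auto simp: scalar_prod_def sum_distrib_left mult.assoc)

text \<open>Every eigenvalue is a root of \<open>(x - a) * (x - b)\<close>. Conversely
  \<open>(A - a I) * (A - b I) = 0\<close>, so any nonzero column of \<open>A - b I\<close> is an
  eigenvector for \<open>a\<close>, and likewise with \<open>a\<close> and \<open>b\<close>
  exchanged.\<close>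

lemma spectrum_of_quadratic:
  fixes A :: "complex mat"
  assumes A: "A \<in> carrier_mat n n"
    and sq: "A * A = (a + b) \<cdot>\<^sub>m A - (a * b) \<cdot>\<^sub>m 1\<^sub>m n"
    and ne: "A \<noteq> a \<cdot>\<^sub>m 1\<^sub>m n" "A \<noteq> b \<cdot>\<^sub>m 1\<^sub>m n"
  shows "spectrum A = {a, b}"
proof
  show "spectrum A \<subseteq> {a, b}"
  proof
    fix k assume "k \<in> spectrum A"
    then obtain v where v: "v \<in> carrier_vec n" "v \<noteq> 0\<^sub>v n" and Av: "A *\<^sub>v v = k \<cdot>\<^sub>v v"
      using A by (auto simp: spectrum_def eigenvalue_def eigenvector_def)
    have "(A * A) *\<^sub>v v = k * k \<cdot>\<^sub>v v"
      using A v(1) Av by (simp add: assoc_mult_mat_vec[of _ n n _ n] mult_mat_vec smult_smult_assoc)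
    moreover have "(A * A) *\<^sub>v v = (a + b) \<cdot>\<^sub>v (k \<cdot>\<^sub>v v) - (a * b) \<cdot>\<^sub>v v"
      using A v(1) unfolding sq Av[symmetric]
      by (simp add: minus_mult_distrib_mat_vec[of _ n n] smult_mat_mult_vec[of _ n n])
    ultimately have eq: "k * k \<cdot>\<^sub>v v = (a + b) \<cdot>\<^sub>v (k \<cdot>\<^sub>v v) - (a * b) \<cdot>\<^sub>v v"
      by simp
    obtain i where i: "i < n" "v $ i \<noteq> 0"
      using v by (metis carrier_vecD eq_vecI index_zero_vec)
    have "k * k * v $ i = (a + b) * (k * v $ i) - a * b * v $ i"
      using arg_cong[OF eq, of "\<lambda>u. u $ i"] i v(1) by simp
    then have "((k - a) * (k - b)) * v $ i = 0"
      by (simp add: algebra_simps)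
    then show "k \<in> {a, b}" using i by simp
  qed
next
  have eig: "c \<in> spectrum A"
    if sq: "A * A = (c + d) \<cdot>\<^sub>m A - (c * d) \<cdot>\<^sub>m 1\<^sub>m n" and ne: "A \<noteq> d \<cdot>\<^sub>m 1\<^sub>m n" for c d
  proof -
    define B where "B = A - d \<cdot>\<^sub>m 1\<^sub>m n"
    have B: "B \<in> carrier_mat n n" using A unfolding B_def by (intro minus_carrier_mat) simp
    obtain i j where ij: "i < n" "j < n" "A $$ (i, j) \<noteq> (d \<cdot>\<^sub>m 1\<^sub>m n) $$ (i, j)"
      using ne A by (metis carrier_matD eq_matI one_carrier_mat smult_carrier_mat)
    have "A * B = A * A - d \<cdot>\<^sub>m A"
      using A by (simp add: B_def mult_minus_distrib_mat[of _ n n _ n] mult_smult_distrib[of _ n n _ n])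
    also have "\<dots> = c \<cdot>\<^sub>m B"
      using A unfolding sq B_def by (intro eq_matI) (auto simp: algebra_simps)
    finally have AB: "A * B = c \<cdot>\<^sub>m B" .
    have "A *\<^sub>v col B j = c \<cdot>\<^sub>v col B j"
      using col_mult2[OF A B ij(2)] B ij by (simp add: AB)
    moreover have "col B j $ i \<noteq> 0"
      using ij A by (simp add: B_def)
    then have "col B j \<noteq> 0\<^sub>v n" using ij by auto
    moreover have "col B j \<in> carrier_vec n"
      using B ij by simp
    ultimately have "eigenvector A (col B j) c"
      using A unfolding eigenvector_def by (simp only: carrier_matD(1)[OF A] simp_thms)
    then show ?thesis
      unfolding spectrum_def eigenvalue_def by blast
  qed
  show "{a, b} \<subseteq> spectrum A"
    using eig[of a b] eig[of b a] sq ne by (simp add: add.commute mult.commute)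
qed

section \<open>Switching equivalence and nontriviality\<close>

text \<open>Switching equivalence states unitarity only for the diagonal factor. For the permutation
  factor it follows by reindexing the sum along \<open>\<pi>\<close>.\<close>

lemma permutation_mat_adjoint_mult:
  assumes P: "permutation_mat P" "P \<in> carrier_mat n n"
  shows "mat_adjoint P * P = 1\<^sub>m n"
proof -
  obtain \<pi> where \<pi>: "\<pi> permutes {..<n}"
    and P_eq: "P = mat n n (\<lambda>(i, j). if j = \<pi> i then 1 else 0)"
    using P by (auto simp: permutation_mat_def)
  show ?thesis
  proof (rule eq_matI)
    fix i j assume ij: "i < dim_row (1\<^sub>m n :: complex mat)" "j < dim_col (1\<^sub>m n :: complex mat)"
    then have "(mat_adjoint P * P) $$ (i, j) =
        (\<Sum>k<n. (if i = \<pi> k then 1 else 0) * (if j = \<pi> k then 1 else 0))"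
      unfolding P_eq
      by (auto simp: mat_adjoint_def scalar_prod_def lessThan_atLeast0 intro!: sum.cong)
    also have "\<dots> = (\<Sum>k<n. (if i = k then 1 else 0) * (if j = k then 1 else 0))"
      by (rule sum.permute[OF \<pi>, unfolded comp_def, symmetric])
    also have "\<dots> = (1\<^sub>m n :: complex mat) $$ (i, j)"
      using ij by (simp add: if_distrib[of "\<lambda>x. x * _"] cong: if_cong)
    finally show "(mat_adjoint P * P) $$ (i, j) = (1\<^sub>m n :: complex mat) $$ (i, j)" .
  qed (simp_all add: P_eq mat_adjoint_def)
qed

lemma mat_adjoint_carrier:
  "A \<in> carrier_mat n m \<Longrightarrow> mat_adjoint A \<in> carrier_mat m n"
  by (auto simp: mat_adjoint_def)

lemma conjugate_mat_square:
  fixes A :: "'a::comm_ring_1 mat"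
  assumes "A \<in> carrier_mat n n" "U \<in> carrier_mat n n" "V \<in> carrier_mat n n"
    and "V * U = 1\<^sub>m n"
  shows "(U * A * V) * (U * A * V) = U * (A * A) * V"
proof -
  have "(U * A * V) * (U * A * V) = U * A * (V * U) * (A * V)"
    using assms(1-3) by (simp add: assoc_mult_mat[of _ n n _ n _ n])
  then show ?thesis
    using assms by (simp add: assoc_mult_mat[of _ n n _ n _ n])
qed

text \<open>The two conjugations merge into one similarity with \<open>U = P * D\<close>, which is
  all that transporting a polynomial equation requires.\<close>

lemma switching_equivalent_conjugate:
  assumes "switching_equivalent A B" "A \<in> carrier_mat n n"
  obtains U V where "U \<in> carrier_mat n n" "V \<in> carrier_mat n n"
    "V * U = 1\<^sub>m n" "U * V = 1\<^sub>m n" "B = U * A * V"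
proof -
  obtain D P where D: "D \<in> carrier_mat n n" "unitary_mat D"
    and P: "P \<in> carrier_mat n n" "permutation_mat P"
    and B: "B = P * (D * A * mat_adjoint D) * mat_adjoint P"
    using assms(1) carrier_matD(1)[OF assms(2)] unfolding switching_equivalent_def by blast
  note adj = mat_adjoint_carrier[OF D(1)] mat_adjoint_carrier[OF P(1)]
  have DD: "mat_adjoint D * D = 1\<^sub>m n"
    using D adj by (auto simp: unitary_mat_def inverts_mat_def)
  have PP: "mat_adjoint P * P = 1\<^sub>m n"
    using permutation_mat_adjoint_mult P by blast
  let ?U = "P * D" and ?V = "mat_adjoint D * mat_adjoint P"
  have U: "?U \<in> carrier_mat n n" and V: "?V \<in> carrier_mat n n"
    using D(1) P(1) adj by simp_all
  have "?V * ?U = mat_adjoint D * (mat_adjoint P * P) * D"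
    using D(1) P(1) adj by (simp add: assoc_mult_mat[of _ n n _ n _ n])
  then have VU: "?V * ?U = 1\<^sub>m n"
    using D(1) adj DD PP by simp
  have "B = ?U * A * ?V"
    using D(1) P(1) adj assms(2) unfolding B by (simp add: assoc_mult_mat[of _ n n _ n _ n])
  with U V VU mat_mult_left_right_inverse[OF V U VU] show thesis
    using that by blast
qed

text \<open>Similarity carries the equation over to an all-ones standard form \<open>S\<close>. Its
  entry \<open>(0, 1)\<close> then reads \<open>- d\<close>, while direct multiplication gives
  \<open>n - 2\<close>.\<close>

lemma nontrivial_of_square:
  fixes c d :: complex
  assumes Q: "Q \<in> carrier_mat n n" "seidel_mat Q" and n: "n \<ge> 2"
    and sq: "Q * Q = c \<cdot>\<^sub>m 1\<^sub>m n - d \<cdot>\<^sub>m Q" and d: "of_nat (n - 2) \<noteq> - d"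
  shows "nontrivial_seidel_mat Q"
  unfolding nontrivial_seidel_mat_def
proof (intro conjI notI)
  assume "trivial_seidel_mat Q"
  then obtain S where S: "seidel_mat S" "switching_equivalent Q S"
    and one: "\<And>i j. i < dim_row S \<Longrightarrow> j < dim_row S \<Longrightarrow> i \<noteq> j \<Longrightarrow> S $$ (i, j) = 1"
    by (auto simp: trivial_seidel_mat_def standard_form_of_def in_standard_form_def)
  obtain U V where U: "U \<in> carrier_mat n n" and V: "V \<in> carrier_mat n n"
    and VU: "V * U = 1\<^sub>m n" and UV: "U * V = 1\<^sub>m n" and S_eq: "S = U * Q * V"
    using switching_equivalent_conjugate[OF S(2) Q(1)] by blast
  have Sc: "S \<in> carrier_mat n n"
    using U V Q(1) by (simp add: S_eq)
  have "S * S = U * (Q * Q) * V"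
    unfolding S_eq by (rule conjugate_mat_square[OF Q(1) U V VU])
  also have "\<dots> = c \<cdot>\<^sub>m 1\<^sub>m n - d \<cdot>\<^sub>m S"
    using Q(1) U V UV unfolding sq S_eq
    by (simp add: mult_minus_distrib_mat[of _ n n _ n] minus_mult_distrib_mat[of _ n n _ _ n]
        mult_smult_distrib[of _ n n _ n] mult_smult_assoc_mat[of _ n n _ n])
  finally have SS: "S * S = c \<cdot>\<^sub>m 1\<^sub>m n - d \<cdot>\<^sub>m S" .
  have diag: "S $$ (i, i) = 0" if "i < n" for i
    using S(1) Sc that by (auto simp: seidel_mat_def)
  have "(S * S) $$ (0, 1) = (\<Sum>k<n. S $$ (0, k) * S $$ (k, 1))"
    using Sc n by (simp add: scalar_prod_def lessThan_atLeast0)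
  \<comment> \<open>The terms for \<open>k = 0\<close> and \<open>k = 1\<close> each contain a
    diagonal entry of \<open>S\<close> and vanish; all others are 1.\<close>
  also have "\<dots> = (\<Sum>k\<in>{..<n} - {0, 1}. 1)"
    using n Sc by (intro sum.mono_neutral_cong_right) (auto simp: diag one)
  also have "\<dots> = of_nat (n - 2)"
    using n by (simp add: card_Diff_subset)
  finally have "(S * S) $$ (0, 1) = of_nat (n - 2)" .
  moreover have "(S * S) $$ (0, 1) = - d"
    using n Sc one[of 0 1] by (simp add: SS)
  ultimately show False using d by simp
qed (rule Q(2))

section \<open>Construction of the signature matrix\<close>

theorem theorem6p3:
  fixes m :: nat
  assumes "m > 0"
  shows "\<exists>Q :: complex mat.
           Q \<in> carrier_mat (9 ^ m) (9 ^ m) \<and>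
           cube_root_signature_mat Q \<and>
           nontrivial_seidel_mat Q \<and>
           Q ^\<^sub>m 2 = (9 ^ m - 1) \<cdot>\<^sub>m 1\<^sub>m (9 ^ m) - 2 \<cdot>\<^sub>m Q"
proof -
  define n :: nat where "n = 9 ^ m"
  \<comment> \<open>The square root of \<open>n\<close>: since \<open>H * H = n I\<close>, the
    eigenvalues of \<open>Q = H - I\<close> can only be \<open>s - 1\<close> and
    \<open>- s - 1\<close>.\<close>
  define s :: complex where "s = 3 ^ m"
  have n: "n \<ge> 2"
    using self_le_power[of "9 :: nat" m] assms by (simp add: n_def)
  have ss: "s * s = 9 ^ m"
    by (simp add: s_def power_mult_distrib[symmetric])
  have ss_n: "s * s = of_nat n"
    by (simp add: ss n_def)
  \<comment> \<open>The first inequality makes the two eigenvalues distinct, the other two make them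
    nonzero.\<close>
  have s_ne: "s \<noteq> 0" "s \<noteq> 1" "s \<noteq> - 1"
    using ss_n n by auto
  obtain h where "cube_root_kernel n h"
    using cube_root_kernel_power_9 unfolding n_def by blast
  then have cube: "\<And>i j. h i j ^ 3 = 1" and inv: "\<And>i j. h i j * h j i = 1"
    and diag: "\<And>i. h i i = 1"
    and orth: "\<And>i j. i < n \<Longrightarrow> j < n \<Longrightarrow> (\<Sum>k<n. h i k * h k j) = (if i = j then of_nat n else 0)"
    by (auto simp: cube_root_kernel_def)
  have norm: "cmod (h i j) = 1" for i j
    using cube[of i j] by (metis power_eq_1_iff zero_neq_numeral)
  \<comment> \<open>On the unit circle the conjugate is the inverse, which the kernel law identifies
    with \<open>h j i\<close>.\<close>
  have cnj: "cnj (h i j) = h j i" for i j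
  proof -
    have "h i j * cnj (h i j) = 1"
      by (simp add: complex_norm_square[symmetric] norm)
    then show ?thesis
      using inv[of i j] by (metis mult_cancel_left mult_zero_left zero_neq_one)
  qed
  define H where "H = mat n n (\<lambda>(i, j). h i j)"
  define Q where "Q = H - 1\<^sub>m n"
  have H: "H \<in> carrier_mat n n" and Q: "Q \<in> carrier_mat n n"
    unfolding H_def Q_def by (auto intro: minus_carrier_mat)
  have Q_entry: "Q $$ (i, j) = (if i = j then 0 else h i j)" if "i < n" "j < n" for i j
    using that by (simp add: Q_def H_def diag)
  have HH: "H * H = of_nat n \<cdot>\<^sub>m 1\<^sub>m n"
    by (rule eq_matI) (simp_all add: H_def scalar_prod_def lessThan_atLeast0[symmetric] orth)
  have "Q * Q = H * H - H - (H - 1\<^sub>m n)"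
    using H Q unfolding Q_def
    by (simp add: minus_mult_distrib_mat[of _ n n _ _ n] mult_minus_distrib_mat[of _ n n _ n])
  also have "\<dots> = (9 ^ m - 1) \<cdot>\<^sub>m 1\<^sub>m n - 2 \<cdot>\<^sub>m Q"
    unfolding HH Q_def ss[symmetric] ss_n using H by (intro eq_matI) (auto simp: algebra_simps)
  finally have QQ: "Q * Q = (9 ^ m - 1) \<cdot>\<^sub>m 1\<^sub>m n - 2 \<cdot>\<^sub>m Q" .
  have seidel: "seidel_mat Q"
    unfolding seidel_mat_def
  proof (intro conjI allI impI)
    show "mat_adjoint Q = Q"
      using Q carrier_matD[OF Q]
      by (intro eq_matI) (auto simp: mat_adjoint_def mat_of_rows_index Q_entry cnj)
  qed (use Q in \<open>auto simp: Q_entry norm\<close>)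
  have "spectrum Q = {s - 1, - s - 1}"
  proof (rule spectrum_of_quadratic[OF Q])
    have "(s - 1) * (- s - 1) = 1 - s * s"
      by (simp add: algebra_simps)
    then show "Q * Q = (s - 1 + (- s - 1)) \<cdot>\<^sub>m Q - ((s - 1) * (- s - 1)) \<cdot>\<^sub>m 1\<^sub>m n"
      unfolding QQ ss[symmetric] using Q by (intro eq_matI) (auto simp: algebra_simps)
    \<comment> \<open>The zero diagonal of \<open>Q\<close> excludes a nonzero scalar matrix,
      already at entry \<open>(0, 0)\<close>.\<close>
    have "Q \<noteq> c \<cdot>\<^sub>m 1\<^sub>m n" if "c \<noteq> 0" for c
      using Q_entry[of 0 0] n that by auto
    then show "Q \<noteq> (s - 1) \<cdot>\<^sub>m 1\<^sub>m n" "Q \<noteq> (- s - 1) \<cdot>\<^sub>m 1\<^sub>m n"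
      using s_ne by (metis eq_iff_diff_eq_0, metis eq_iff_diff_eq_0 minus_equation_iff)
  qed
  then have "card (spectrum Q) = 2"
    using s_ne by (auto simp: card_insert_if)
  then have "cube_root_signature_mat Q"
    using seidel Q by (auto simp: cube_root_signature_mat_def cube_root_seidel_mat_def Q_entry cube)
  \<comment> \<open>Here \<open>d = 2\<close>, so equality would force \<open>n = 0\<close>.\<close>
  moreover have "of_nat (n - 2) \<noteq> (- 2 :: complex)"
    using n by simp
  then have "nontrivial_seidel_mat Q"
    using nontrivial_of_square[OF Q seidel n QQ] by simp
  moreover have "Q ^\<^sub>m 2 = Q * Q"
    using Q by (simp add: numeral_2_eq_2)
  ultimately show ?thesis
    using Q QQ unfolding n_def by auto
qed

end
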